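(* For each computable ordinal $\alpha<\omega_1^{CK}$ there is an automatic structure $\mathcal A=(A;R)$ with $R$ a well-founded binary relation whose ordinal height is greater than $\alpha$.
   Context: $\omega_1^{CK}$ is the least ordinal that is not the order type of a computable well-ordering of the natural numbers. Automatic structures: for a finite alphabet $\Sigma$ and a padding symbol $\diamond\notin\Sigma$, the convolution of a tuple $(w_1,\dots,w_n)$ of words over $\Sigma$ is the word of length $\max_i|w_i|$ over $(\Sigma\cup\{\diamond\})^n$ whose $k$-th letter is $(\sigma_1,\dots,\sigma_n)$, with $\sigma_i$ the $k$-th letter of $w_i$ if $k\le|w_i|$ and $\diamond$ otherwise. A relation on $\Sigma^\star$ is regular if the set of convolutions of its tuples is accepted by a finite automaton. A structure $(A;R_1,\dots,R_m)$ is automatic if $A\subseteq\Sigma^\star$ is regular and each $R_i$ is regular (or the structure is isomorphic to such). A binary relation $R$ is well-founded if there is no infinite sequence $x_1,x_2,\dots$ with $(x_{i+1},x_i)\in R$ for all $i$. Ordinal height: $r_{\mathcal A}(x)=0$ for $R$-minimal $x$, $r_{\mathcal A}(z)=\sup\{r_{\mathcal A}(y)+1:(y,z)\in R\}$ otherwise, and $r(\mathcal A)=\sup\{r_{\mathcal A}(x):x\in A\}$. *)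

theory Defs
  imports "HOL-Library.Countable_Set_Type"
begin

unbundle cardinal_syntax

section \<open>Countable ordinals\<close>

text \<open>
  HOL has no type of all ordinals. The ordinals below are the isomorphism classes of the
  well-orders whose field is a (possibly empty, finite or infinite) subset of the natural
  numbers, that is, all countable ordinals. Heights of well-founded relations on sets of words
  and order types of computable well-orders are countable, so nothing else is needed. Note
  that \<open>r =o s\<close> includes the condition that \<open>r\<close> and \<open>s\<close> are well-orders.
\<close>

quotient_type cord = "nat rel" / partial: "\<lambda>r s. r =o s"
  morphisms rep_cord ordtype
proof (rule part_equivpI)
  show "\<exists>r :: nat rel. r =o r"
    using natLeq_Well_order ordIso_reflexive by blast
  show "symp (\<lambda>r s :: nat rel. r =o s)"
    by (auto intro: sympI ordIso_symmetric)
  show "transp (\<lambda>r s :: nat rel. r =o s)"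
    by (auto intro: transpI ordIso_transitive)
qed

instantiation cord :: linorder
begin

lift_definition less_eq_cord :: "cord \<Rightarrow> cord \<Rightarrow> bool" is "\<lambda>r s. r \<le>o s"
  by (meson ordIso_ordLeq_trans ordIso_symmetric ordLeq_ordIso_trans)

lift_definition less_cord :: "cord \<Rightarrow> cord \<Rightarrow> bool" is "\<lambda>r s. r <o s"
  by (meson ordIso_ordLess_trans ordIso_symmetric ordLess_ordIso_trans)

instance
proof
  fix a b c :: cord
  show "a < b \<longleftrightarrow> a \<le> b \<and> \<not> b \<le> a"
    by transfer (meson not_ordLess_ordLeq ordIso_def ordLess_or_ordLeq ordLess_imp_ordLeq
        ordIso_imp_ordLeq ordLeq_Well_order_simp)
  show "a \<le> a"
    by transfer (simp add: ordIso_imp_ordLeq)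
  show "a \<le> b \<Longrightarrow> b \<le> c \<Longrightarrow> a \<le> c"
    by transfer (rule ordLeq_transitive)
  show "a \<le> b \<Longrightarrow> b \<le> a \<Longrightarrow> a = b"
    by transfer (simp add: ordIso_iff_ordLeq)
  show "a \<le> b \<or> b \<le> a"
    by transfer (meson ordIso_imp_ordLeq ordLeq_Well_order_simp ordLeq_total)
qed

end

lemma wf_less_cord: "wf {(a, b). a < (b :: cord)}"
proof -
  have "{(a, b). a < (b :: cord)} \<subseteq> inv_image ordLess rep_cord"
  proof clarify
    fix a b :: cord
    assume "a < b"
    then have "ordtype (rep_cord a) < ordtype (rep_cord b)"
      by (simp add: Quotient3_abs_rep[OF Quotient3_cord])
    then show "(a, b) \<in> inv_image ordLess rep_cord"
      using Quotient3_rep_reflp[OF Quotient3_cord]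
      by (simp add: less_cord.abs_eq)
  qed
  then show ?thesis
    using wf_inv_image[OF wf_ordLess] wf_subset by blast
qed

instance cord :: wellorder
proof
  fix P :: "cord \<Rightarrow> bool" and a
  assume *: "\<And>x. (\<And>y. y < x \<Longrightarrow> P y) \<Longrightarrow> P x"
  show "P a"
    by (rule wf_induct_rule[OF wf_less_cord]) (auto intro: *)
qed

definition succ_ord :: "cord \<Rightarrow> cord" where
  "succ_ord a = (LEAST b. a < b)"

definition sup_ord :: "cord set \<Rightarrow> cord" where
  "sup_ord S = (LEAST b. \<forall>a\<in>S. a \<le> b)"

text \<open>
  Countable sets of countable ordinals are strictly bounded, so both operations have their
  intended meaning wherever they are used. The supremum of the empty set is the least ordinal.
\<close>

lemma ex_cord_greater:
  assumes "countable S"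
  shows "\<exists>b :: cord. \<forall>a\<in>S. a < b"
proof -
  define W where "W = cardSuc natLeq"
  have cW: "Card_order W"
    unfolding W_def by (rule cardSuc_Card_order[OF natLeq_Card_order])
  then have wW: "Well_order W"
    by (simp add: card_order_on_def)
  then have transW: "trans W" and antisymW: "antisym W" and totalW: "Total W" and reflW: "Refl W"
    by (simp_all add: order_on_defs)
  have infW: "infinite (Field W)"
    unfolding W_def using natLeq_Card_order Field_natLeq by (simp add: cardSuc_finite)
  have reg: "regularCard W"
    unfolding W_def
    by (rule infinite_cardSuc_regularCard[OF _ natLeq_Card_order]) (simp add: Field_natLeq)
  have small: "|A| <o W" if "countable A" for A :: "'a set"
  proof -
    have "|A| \<le>o natLeq"
      using that countable_card_le_natLeq by blast
    then show ?thesis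
      unfolding W_def using cardSuc_ordLeq_ordLess[OF natLeq_Card_order card_of_Card_order] by blast
  qed
  have wr: "Well_order (rep_cord a)" for a
    using Quotient3_rep_reflp[OF Quotient3_cord, of a] by (simp add: ordIso_def)
  have "\<exists>x. x \<in> Field W \<and> rep_cord a =o Restr W (underS W x)" for a
  proof -
    have "\<not> W \<le>o rep_cord a"
    proof
      assume "W \<le>o rep_cord a"
      then have "|Field W| \<le>o |Field (rep_cord a)|"
        by (rule card_of_mono2)
      then have "W \<le>o |Field (rep_cord a)|"
        using cW Card_order_iff_ordIso_card_of ordIso_ordLeq_trans by blast
      moreover have "|Field (rep_cord a)| <o W"
        by (rule small) simp
      ultimately show False
        using not_ordLess_ordLeq by blast
    qed
    then show ?thesis
      using wr wW ordLess_or_ordLeq ordLess_iff_ordIso_Restr by blast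
  qed
  then obtain f where f: "\<And>a. f a \<in> Field W" "\<And>a. rep_cord a =o Restr W (underS W (f a))"
    by metis
  have "|f ` S| <o W"
    by (rule small) (simp add: assms)
  then have "\<not> cofinal (f ` S) W"
    using reg f(1) not_ordLess_ordIso unfolding regularCard_def by blast
  then obtain x where x: "x \<in> Field W" "\<And>a. a \<in> S \<Longrightarrow> f a = x \<or> (x, f a) \<notin> W"
    unfolding cofinal_def by auto
  obtain z where z: "z \<in> Field W" "x \<noteq> z" "(x, z) \<in> W"
    using infinite_Card_order_limit[OF cW infW x(1)] by blast
  let ?T = "Restr W (underS W z)"
  have wT: "Well_order ?T"
    by (rule Well_order_Restr[OF wW])
  have "|underS W z| <o cardSuc natLeq"
    using card_of_underS[OF cW z(1)] by (simp add: W_def)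
  then have "|underS W z| \<le>o natLeq"
    using cardSuc_ordLeq_ordLess[OF natLeq_Card_order card_of_Card_order] by blast
  then have "countable (underS W z)"
    using countable_card_le_natLeq by blast
  then have "countable (Field ?T)"
    by (rule countable_subset[rotated]) (auto simp: Field_def)
  then obtain g :: "_ \<Rightarrow> nat" where g: "inj_on g (Field ?T)"
    by (auto simp: countable_def)
  then have iso: "?T =o dir_image ?T g"
    by (rule dir_image_ordIso[OF wT])
  have "a < ordtype (dir_image ?T g)" if a: "a \<in> S" for a
  proof -
    have "(f a, x) \<in> W"
      using x(2)[OF a] x(1) f(1)[of a] totalW reflW by (cases "f a = x") (auto simp: total_on_def refl_on_def)
    then have lt: "(f a, z) \<in> W" "f a \<noteq> z"
      using z transW antisymW by (meson transD, meson antisymD)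
    then have "underS W (f a) \<subseteq> underS W z"
      using transW antisymW unfolding underS_def by (blast dest: transD antisymD)
    moreover have "f a \<in> underS W z" "f a \<notin> underS W (f a)"
      using lt by (simp_all add: underS_def)
    ultimately have "underS W (f a) \<subset> underS W z"
      by blast
    then have "Restr W (underS W (f a)) <o ?T"
      using ofilter_subset_ordLess[OF wW] wo_rel.underS_ofilter[of W] wW
      by (simp add: wo_rel_def)
    then have "rep_cord a <o dir_image ?T g"
      using f(2) iso ordIso_ordLess_trans ordLess_ordIso_trans by blast
    moreover have "dir_image ?T g =o dir_image ?T g"
      using iso ordIso_symmetric ordIso_transitive by blast
    ultimately have "ordtype (rep_cord a) < ordtype (dir_image ?T g)"
      using Quotient3_rep_reflp[OF Quotient3_cord, of a] by (simp add: less_cord.abs_eq)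
    then show ?thesis
      by (simp add: Quotient3_abs_rep[OF Quotient3_cord])
  qed
  then show ?thesis by blast
qed

lemma succ_ord_greater: "a < succ_ord a"
  unfolding succ_ord_def using ex_cord_greater[of "{a}"] by (auto intro: LeastI_ex)

lemma sup_ord_upper:
  assumes "countable S" "a \<in> S"
  shows "a \<le> sup_ord S"
proof -
  have "\<exists>b. \<forall>a\<in>S. a \<le> b"
    using ex_cord_greater[OF assms(1)] less_imp_le by blast
  then have "\<forall>a\<in>S. a \<le> sup_ord S"
    unfolding sup_ord_def by (rule LeastI_ex)
  then show ?thesis using assms(2) by blast
qed

lemma sup_ord_least: "(\<And>a. a \<in> S \<Longrightarrow> a \<le> b) \<Longrightarrow> sup_ord S \<le> b"
  unfolding sup_ord_def by (simp add: Least_le)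


section \<open>Computable well-orders and \<open>\<omega>\<^sub>1\<^sup>C\<^sup>K\<close>\<close>

text \<open>
  Computability is defined by Minsky register machines: \<open>Inc r\<close> increments register \<open>r\<close> and goes
  on with the next instruction; \<open>Dec r l\<close> jumps to instruction \<open>l\<close> if register \<open>r\<close> is zero, and
  otherwise decrements it and goes on with the next instruction. The machine halts when
  the program counter leaves the program; register \<open>0\<close> then holds the result.
\<close>

datatype instr = Inc nat | Dec nat nat

instance instr :: countable
  by countable_datatype

type_synonym prog = "instr list"
type_synonym config = "nat \<times> (nat \<Rightarrow> nat)"

fun exec :: "instr \<Rightarrow> config \<Rightarrow> config" where
  "exec (Inc r) (pc, \<rho>) = (Suc pc, \<rho>(r := Suc (\<rho> r)))"
| "exec (Dec r l) (pc, \<rho>) = (if \<rho> r = 0 then (l, \<rho>) else (Suc pc, \<rho>(r := \<rho> r - 1)))"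

definition halted :: "prog \<Rightarrow> config \<Rightarrow> bool" where
  "halted P c \<longleftrightarrow> length P \<le> fst c"

definition step :: "prog \<Rightarrow> config \<Rightarrow> config" where
  "step P c = (if halted P c then c else exec (P ! fst c) c)"

definition initial :: "nat list \<Rightarrow> config" where
  "initial xs = (0, \<lambda>i. if i < length xs then xs ! i else 0)"

definition computes :: "prog \<Rightarrow> nat list \<Rightarrow> nat \<Rightarrow> bool" where
  "computes P xs v \<longleftrightarrow>
     (\<exists>n. halted P ((step P ^^ n) (initial xs)) \<and> snd ((step P ^^ n) (initial xs)) 0 = v)"

definition computable_rel :: "nat rel \<Rightarrow> bool" where
  "computable_rel S \<longleftrightarrow> (\<exists>P. \<forall>x y. computes P [x, y] (if (x, y) \<in> S then 1 else 0))"

text \<open>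
  Well-orders are reflexive on their field, so the field of a computable well-order is a
  computable set of natural numbers. It need not be the set of all natural numbers: otherwise
  no finite ordinal would be computable.
\<close>

definition computable_ord :: "cord \<Rightarrow> bool" where
  "computable_ord \<alpha> \<longleftrightarrow> (\<exists>r. Well_order r \<and> computable_rel r \<and> \<alpha> = ordtype r)"

definition omega1CK :: cord where
  "omega1CK = (LEAST \<alpha>. \<not> computable_ord \<alpha>)"

lemma computes_unique:
  assumes "computes P xs v" "computes P xs w"
  shows "v = w"
proof -
  have stay: "(step P ^^ (k + n)) c = (step P ^^ n) c" if "halted P ((step P ^^ n) c)" for k n c
    using that by (induction k) (auto simp: step_def)
  obtain n m where n: "halted P ((step P ^^ n) (initial xs))" "snd ((step P ^^ n) (initial xs)) 0 = v"
    and m: "halted P ((step P ^^ m) (initial xs))" "snd ((step P ^^ m) (initial xs)) 0 = w"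
    using assms by (auto simp: computes_def)
  show ?thesis
    using stay[OF n(1), of m] stay[OF m(1), of n] n(2) m(2) by (simp add: add.commute)
qed

lemma not_computable_omega1CK: "\<not> computable_ord omega1CK"
proof -
  define rel where "rel = (\<lambda>P. {(x, y). computes P [x, y] 1})"
  have "r \<in> range rel" if "computable_rel r" for r
  proof -
    obtain P where "\<And>x y. computes P [x, y] (if (x, y) \<in> r then 1 else 0)"
      using \<open>computable_rel r\<close> by (auto simp: computable_rel_def)
    then have "(x, y) \<in> r \<longleftrightarrow> computes P [x, y] 1" for x y
      using computes_unique[of P "[x, y]" 1 0] by (metis zero_neq_one)
    then have "r = rel P"
      by (auto simp: rel_def)
    then show ?thesis by blast
  qed
  then have "{\<alpha>. computable_ord \<alpha>} \<subseteq> ordtype ` range rel"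
    unfolding computable_ord_def by blast
  then have "countable {\<alpha>. computable_ord \<alpha>}"
    by (rule countable_subset) (intro countable_image countableI_type)
  then obtain b where "\<forall>a \<in> {\<alpha>. computable_ord \<alpha>}. a < b"
    using ex_cord_greater by meson
  then have "\<not> computable_ord b"
    using less_irrefl[of b] by auto
  then show ?thesis
    unfolding omega1CK_def by (rule LeastI)
qed

lemma less_omega1CK_computable: "\<alpha> < omega1CK \<Longrightarrow> computable_ord \<alpha>"
  unfolding omega1CK_def using not_less_Least by blast


section \<open>Automatic structures\<close>

record 'a automaton =
  states :: "nat set"
  start :: nat
  transitions :: "(nat \<times> 'a \<times> nat) set"
  accepting :: "nat set"

definition finite_automaton :: "'a set \<Rightarrow> 'a automaton \<Rightarrow> bool" where
  "finite_automaton \<Gamma> M \<longleftrightarrow> finite \<Gamma> \<and> finite (states M) \<and> start M \<in> states M \<and>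
     transitions M \<subseteq> states M \<times> \<Gamma> \<times> states M \<and> accepting M \<subseteq> states M"

primrec run :: "'a automaton \<Rightarrow> nat \<Rightarrow> 'a list \<Rightarrow> nat \<Rightarrow> bool" where
  "run M p [] q \<longleftrightarrow> p = q"
| "run M p (a # w) q \<longleftrightarrow> (\<exists>p'. (p, a, p') \<in> transitions M \<and> run M p' w q)"

definition language :: "'a automaton \<Rightarrow> 'a list set" where
  "language M = {w. \<exists>q \<in> accepting M. run M (start M) w q}"

definition regular :: "'a set \<Rightarrow> 'a list set \<Rightarrow> bool" where
  "regular \<Gamma> L \<longleftrightarrow> (\<exists>M. finite_automaton \<Gamma> M \<and> language M = L)"

text \<open>Tuples are lists, and the padding symbol is \<^const>\<open>None\<close>.\<close>

definition convolution :: "'a list list \<Rightarrow> 'a option list list" where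
  "convolution ws = map (\<lambda>k. map (\<lambda>w. if k < length w then Some (w ! k) else None) ws)
     [0..<Max (length ` set ws)]"

definition padded_letters :: "'a set \<Rightarrow> nat \<Rightarrow> 'a option list set" where
  "padded_letters \<Sigma> n = {\<sigma>. length \<sigma> = n \<and> set \<sigma> \<subseteq> insert None (Some ` \<Sigma>)}"

definition regular_rel :: "'a set \<Rightarrow> nat \<Rightarrow> 'a list list set \<Rightarrow> bool" where
  "regular_rel \<Sigma> n S \<longleftrightarrow> S \<subseteq> {ws. length ws = n \<and> set ws \<subseteq> lists \<Sigma>} \<and>
     regular (padded_letters \<Sigma> n) (convolution ` S)"

text \<open>
  A relational structure with domain \<open>A\<close>, given by the list of its relations together with
  their arities.
\<close>

definition automatic :: "'a list set \<Rightarrow> (nat \<times> 'a list list set) list \<Rightarrow> bool" where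
  "automatic A Rs \<longleftrightarrow> (\<exists>\<Sigma>. finite \<Sigma> \<and> A \<subseteq> lists \<Sigma> \<and> regular \<Sigma> A \<and>
     (\<forall>(n, S) \<in> set Rs. S \<subseteq> {ws. length ws = n \<and> set ws \<subseteq> A} \<and> regular_rel \<Sigma> n S))"

definition tuples :: "'a rel \<Rightarrow> 'a list set" where
  "tuples R = {[x, y] | x y. (x, y) \<in> R}"


section \<open>Ordinal height\<close>

text \<open>For \<open>R\<close>-minimal elements the supremum is empty, hence the least ordinal.\<close>

definition ordinal_rank :: "'a rel \<Rightarrow> 'a \<Rightarrow> cord" where
  "ordinal_rank R = wfrec R (\<lambda>h z. sup_ord {succ_ord (h y) | y. (y, z) \<in> R})"

lemma ordinal_rank_eq:
  assumes "wf R"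
  shows "ordinal_rank R z = sup_ord {succ_ord (ordinal_rank R y) | y. (y, z) \<in> R}"
proof -
  have "ordinal_rank R z = sup_ord {succ_ord (cut (ordinal_rank R) R z y) | y. (y, z) \<in> R}"
    unfolding ordinal_rank_def by (subst wfrec[OF assms]) (rule refl)
  also have "{succ_ord (cut (ordinal_rank R) R z y) | y. (y, z) \<in> R} =
      {succ_ord (ordinal_rank R y) | y. (y, z) \<in> R}"
    by (intro Collect_cong ex_cong1) (auto simp: cut_apply)
  finally show ?thesis .
qed

definition ordinal_height :: "'a set \<Rightarrow> 'a rel \<Rightarrow> cord" where
  "ordinal_height A R = sup_ord (ordinal_rank R ` A)"

end

theory Submission
  imports Defs
begin

text \<open>
  Let a register machine decide the well-order \<open>r\<close>. From a start configuration holding \<open>x\<close>, one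
  step down in \<open>R\<close> guesses a number \<open>y \<noteq> x\<close> and a clock value, and the following steps simulate the
  machine on \<open>(y, x)\<close> while the clock counts down; if the machine halts with output \<open>1\<close>, the descent
  goes on to the start configuration of \<open>y\<close>. The clock makes every simulation finite, even from
  configurations that do not belong to a computation, so an infinite descent passes through
  infinitely many start configurations and, after the first one, yields an infinite
  \<open>r\<close>-descending sequence. Conversely, \<open>r\<close> embeds into the start configurations, and two more
  elements on top push the height above the order type of \<open>r\<close>.

  Words carry the registers as parallel unary tracks. All steps then compare only adjacent letters,
  so \<open>R\<close> is recognised by a finite automaton.
\<close>

section \<open>Locally testable languages\<close>

text \<open>The letter \<open>e\<close> serves as end marker, and the modes \<open>\<theta>\<close> make the class closed under finite
  unions.\<close>

lemma regular_local:
  fixes D :: "'m \<Rightarrow> 'a \<Rightarrow> 'a \<Rightarrow> bool"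
  assumes "finite \<Gamma>" "finite \<Theta>"
  shows "regular \<Gamma> {w \<in> lists \<Gamma>. w \<noteq> [] \<and> (\<exists>\<theta>\<in>\<Theta>. F \<theta> (hd w) \<and>
    (\<forall>k<length w. D \<theta> (w ! k) (if Suc k < length w then w ! Suc k else e)))}"
    (is "regular \<Gamma> ?L")
proof -
  obtain g :: "'m \<times> 'a \<Rightarrow> nat" where g: "inj_on g (\<Theta> \<times> \<Gamma>)"
    using finite_imp_inj_to_nat_seg[of "\<Theta> \<times> \<Gamma>"] assms by blast
  \<comment> \<open>The state \<open>Suc (g (\<theta>, a))\<close> stores the mode, fixed at the
    first letter, and the letter read last. Each transition checks one adjacent pair; acceptance
    checks the last letter against \<open>e\<close>.\<close>
  define M :: "'a automaton" where "M = \<lparr>states = insert 0 (Suc ` g ` (\<Theta> \<times> \<Gamma>)), start = 0,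
    transitions = {(0, a, Suc (g (\<theta>, a))) | \<theta> a. \<theta> \<in> \<Theta> \<and> a \<in> \<Gamma> \<and> F \<theta> a} \<union>
      {(Suc (g (\<theta>, a)), b, Suc (g (\<theta>, b))) | \<theta> a b. \<theta> \<in> \<Theta> \<and> a \<in> \<Gamma> \<and> b \<in> \<Gamma> \<and> D \<theta> a b},
    accepting = {Suc (g (\<theta>, a)) | \<theta> a. \<theta> \<in> \<Theta> \<and> a \<in> \<Gamma> \<and> D \<theta> a e}\<rparr>"
  have fin: "finite_automaton \<Gamma> M"
    using assms by (auto simp: finite_automaton_def M_def)
  have g_eq: "g (\<theta>, a) = g (\<theta>', a') \<longleftrightarrow> \<theta> = \<theta>' \<and> a = a'"
    if "\<theta> \<in> \<Theta>" "a \<in> \<Gamma>" "\<theta>' \<in> \<Theta>" "a' \<in> \<Gamma>" for \<theta> a \<theta>' a'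
    using g that by (auto simp: inj_on_def)
  have run: "(\<exists>q\<in>accepting M. run M (Suc (g (\<theta>, a))) w q) \<longleftrightarrow> w \<in> lists \<Gamma> \<and>
      (\<forall>k<length (a # w). D \<theta> ((a # w) ! k) (if Suc k < length (a # w) then (a # w) ! Suc k else e))"
    if "\<theta> \<in> \<Theta>" "a \<in> \<Gamma>" for \<theta> a w
    using that
  proof (induction w arbitrary: a)
    case Nil
    then show ?case by (auto simp: M_def g_eq)
  next
    case (Cons b w)
    have "(\<exists>q\<in>accepting M. run M (Suc (g (\<theta>, a))) (b # w) q) \<longleftrightarrow>
        b \<in> \<Gamma> \<and> D \<theta> a b \<and> (\<exists>q\<in>accepting M. run M (Suc (g (\<theta>, b))) w q)"
      using Cons.prems by (fastforce simp: M_def g_eq)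
    also have "\<dots> \<longleftrightarrow> b \<in> \<Gamma> \<and> D \<theta> a b \<and> w \<in> lists \<Gamma> \<and>
      (\<forall>k<length (b # w). D \<theta> ((b # w) ! k) (if Suc k < length (b # w) then (b # w) ! Suc k else e))"
      using Cons.IH[of b] Cons.prems by blast
    finally show ?case
      by (subst length_Cons, subst All_less_Suc2) auto
  qed
  have "w \<in> language M \<longleftrightarrow> w \<in> ?L" for w
  proof (cases w)
    case Nil
    then show ?thesis by (auto simp: language_def M_def)
  next
    case (Cons a v)
    have "w \<in> language M \<longleftrightarrow> a \<in> \<Gamma> \<and> (\<exists>\<theta>\<in>\<Theta>. F \<theta> a \<and>
        (\<exists>q\<in>accepting M. run M (Suc (g (\<theta>, a))) v q))"
      unfolding Cons language_def by (fastforce simp: M_def)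
    also have "\<dots> \<longleftrightarrow> a \<in> \<Gamma> \<and> (\<exists>\<theta>\<in>\<Theta>. F \<theta> a \<and> v \<in> lists \<Gamma> \<and>
        (\<forall>k<length w. D \<theta> (w ! k) (if Suc k < length w then w ! Suc k else e)))"
      unfolding Cons using run[of _ a v] by blast
    finally show ?thesis
      unfolding Cons by auto
  qed
  then show ?thesis
    unfolding regular_def using fin by blast
qed

lemma regular_lists:
  assumes "finite \<Sigma>"
  shows "regular \<Sigma> (lists \<Sigma>)"
proof -
  define M :: "'a automaton" where
    "M = \<lparr>states = {0}, start = 0, transitions = {0} \<times> \<Sigma> \<times> {0}, accepting = {0}\<rparr>"
  have "run M 0 w 0 \<longleftrightarrow> w \<in> lists \<Sigma>" for w
    by (induction w) (auto simp: M_def)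
  then have "language M = lists \<Sigma>"
    by (auto simp: language_def M_def)
  moreover have "finite_automaton \<Sigma> M"
    using assms by (simp add: finite_automaton_def M_def)
  ultimately show ?thesis
    unfolding regular_def by blast
qed


section \<open>Unary encoding of register contents\<close>

text \<open>With each register written in unary on its own track, this is the column at position
  \<open>k\<close>.\<close>

definition bits :: "(nat \<Rightarrow> nat) \<Rightarrow> nat \<Rightarrow> nat set" where
  "bits \<rho> k = {i. k < \<rho> i}"

text \<open>The form that a finite automaton can check: \<open>F\<close> inspects the first columns,
  \<open>D\<close> each adjacent pair of columns. Since \<open>k\<close> is unbounded,
  \<open>D\<close> is also asked about the empty columns past the ends of both words.\<close>

definition local_rel :: "((nat \<Rightarrow> nat) \<Rightarrow> (nat \<Rightarrow> nat) \<Rightarrow> bool) \<Rightarrow> bool" where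
  "local_rel S \<longleftrightarrow> (\<exists>F D. \<forall>\<rho>' \<rho>. S \<rho>' \<rho> \<longleftrightarrow> F (bits \<rho>' 0) (bits \<rho> 0) \<and>
     (\<forall>k. D (bits \<rho>' k) (bits \<rho> k) (bits \<rho>' (Suc k)) (bits \<rho> (Suc k))))"

lemma local_relI:
  assumes "\<And>\<rho>' \<rho>. S \<rho>' \<rho> \<longleftrightarrow> F (bits \<rho>' 0) (bits \<rho> 0) \<and>
     (\<forall>k. D (bits \<rho>' k) (bits \<rho> k) (bits \<rho>' (Suc k)) (bits \<rho> (Suc k)))"
  shows "local_rel S"
  unfolding local_rel_def using assms by blast

lemma local_rel_Ball:
  assumes "\<And>i. i \<in> I \<Longrightarrow> local_rel (S i)"
  shows "local_rel (\<lambda>\<rho>' \<rho>. \<forall>i\<in>I. S i \<rho>' \<rho>)"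
proof -
  obtain F D where FD: "\<And>i \<rho>' \<rho>. i \<in> I \<Longrightarrow> S i \<rho>' \<rho> \<longleftrightarrow> F i (bits \<rho>' 0) (bits \<rho> 0) \<and>
     (\<forall>k. D i (bits \<rho>' k) (bits \<rho> k) (bits \<rho>' (Suc k)) (bits \<rho> (Suc k)))"
    using assms unfolding local_rel_def by metis
  show ?thesis
    by (rule local_relI[where F = "\<lambda>X' X. \<forall>i\<in>I. F i X' X"
          and D = "\<lambda>X' X Y' Y. \<forall>i\<in>I. D i X' X Y' Y"]) (auto simp: FD)
qed

lemma local_rel_conj:
  assumes "local_rel S" "local_rel T"
  shows "local_rel (\<lambda>\<rho>' \<rho>. S \<rho>' \<rho> \<and> T \<rho>' \<rho>)"
proof -
  have "local_rel (\<lambda>\<rho>' \<rho>. \<forall>b\<in>UNIV. (if b then S else T) \<rho>' \<rho>)"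
    by (rule local_rel_Ball) (simp add: assms)
  moreover have "(\<forall>b\<in>UNIV. (if b then S else T) \<rho>' \<rho>) \<longleftrightarrow> S \<rho>' \<rho> \<and> T \<rho>' \<rho>" for \<rho>' \<rho>
    by (metis (full_types) UNIV_I)
  ultimately show ?thesis by simp
qed

text \<open>As \<open>B\<close> is any predicate on truth values, this covers constants as well as
  jump targets that depend on a zero test.\<close>

lemma local_rel_first: "local_rel (\<lambda>\<rho>' \<rho>. B (\<rho> i = 0))"
  by (rule local_relI[where F = "\<lambda>X' X. B (i \<notin> X)" and D = "\<lambda>_ _ _ _. True"]) (simp add: bits_def)

lemma local_rel_const: "local_rel (\<lambda>_ _. b)"
  by (rule local_rel_first)

lemma local_rel_zero: "local_rel (\<lambda>\<rho>' \<rho>. \<rho>' i = 0)"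
  by (rule local_relI[where F = "\<lambda>X' X. i \<notin> X'" and D = "\<lambda>_ _ _ _. True"]) (simp add: bits_def)

lemma nat_eq_iff_less: "(m :: nat) = n \<longleftrightarrow> (\<forall>k. k < m \<longleftrightarrow> k < n)"
proof
  assume *: "\<forall>k. k < m \<longleftrightarrow> k < n"
  show "m = n"
    using *[THEN spec, of m] *[THEN spec, of n] by simp
qed simp

text \<open>An increment shifts a unary track by one position and fills the first one, so
  neighbouring columns suffice to check it.\<close>

lemma nat_eq_Suc_iff_less: "m = Suc n \<longleftrightarrow> 0 < m \<and> (\<forall>k. Suc k < m \<longleftrightarrow> k < n)"
  by (cases m) (simp_all flip: nat_eq_iff_less)

text \<open>Shifting the other way drops the first mark; an empty track stays empty, in accordance
  with \<open>0 - 1 = 0\<close>.\<close>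

lemma nat_eq_pred_iff_less: "m = n - Suc 0 \<longleftrightarrow> (\<forall>k. k < m \<longleftrightarrow> Suc k < n)"
  by (cases n) (auto simp flip: nat_eq_iff_less)

lemma local_rel_eq: "local_rel (\<lambda>\<rho>' \<rho>. \<rho>' i = \<rho> j)"
  by (rule local_relI[where F = "\<lambda>_ _. True" and D = "\<lambda>X' X Y' Y. i \<in> X' \<longleftrightarrow> j \<in> X"])
    (simp add: bits_def flip: nat_eq_iff_less)

lemma local_rel_eq_left: "local_rel (\<lambda>\<rho>' \<rho>. \<rho>' i = \<rho>' j)"
  by (rule local_relI[where F = "\<lambda>_ _. True" and D = "\<lambda>X' X Y' Y. i \<in> X' \<longleftrightarrow> j \<in> X'"])
    (simp add: bits_def flip: nat_eq_iff_less)

lemma local_rel_Suc: "local_rel (\<lambda>\<rho>' \<rho>. \<rho>' i = Suc (\<rho> j))"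
  by (rule local_relI[where F = "\<lambda>X' X. i \<in> X'" and D = "\<lambda>X' X Y' Y. i \<in> Y' \<longleftrightarrow> j \<in> X"])
    (simp add: bits_def nat_eq_Suc_iff_less)

lemma local_rel_eq_Suc: "local_rel (\<lambda>\<rho>' \<rho>. \<rho> i = Suc (\<rho>' j))"
  by (rule local_relI[where F = "\<lambda>X' X. i \<in> X" and D = "\<lambda>X' X Y' Y. i \<in> Y \<longleftrightarrow> j \<in> X'"])
    (simp add: bits_def nat_eq_Suc_iff_less)

lemma local_rel_pred: "local_rel (\<lambda>\<rho>' \<rho>. \<rho>' i = \<rho> j - 1)"
  by (rule local_relI[where F = "\<lambda>_ _. True" and D = "\<lambda>X' X Y' Y. i \<in> X' \<longleftrightarrow> j \<in> Y"])
    (simp add: bits_def nat_eq_pred_iff_less)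

lemma local_rel_one: "local_rel (\<lambda>\<rho>' \<rho>. \<rho> i = 1)"
  by (rule local_relI[where F = "\<lambda>X' X. i \<in> X" and D = "\<lambda>X' X Y' Y. i \<notin> Y"])
    (auto simp: bits_def nat_eq_Suc_iff_less)

text \<open>Inequality of two registers is not local, but becomes so once a third register marks a
  position at which their unary encodings differ.\<close>

lemma local_rel_differ: "local_rel (\<lambda>\<rho>' \<rho>. (\<rho>' d < \<rho>' i) \<noteq> (\<rho>' d < \<rho> j))"
proof (rule local_relI[where F = "\<lambda>X' X. d \<notin> X' \<longrightarrow> (i \<in> X') \<noteq> (j \<in> X)"
      and D = "\<lambda>X' X Y' Y. d \<in> X' \<and> d \<notin> Y' \<longrightarrow> (i \<in> Y') \<noteq> (j \<in> Y)"])
  fix \<rho>' \<rho> :: "nat \<Rightarrow> nat"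
  have "k < \<rho>' d \<and> \<not> Suc k < \<rho>' d \<longleftrightarrow> \<rho>' d = Suc k" for k
    by auto
  then show "(\<rho>' d < \<rho>' i) \<noteq> (\<rho>' d < \<rho> j) \<longleftrightarrow>
      (d \<notin> bits \<rho>' 0 \<longrightarrow> (i \<in> bits \<rho>' 0) \<noteq> (j \<in> bits \<rho> 0)) \<and>
      (\<forall>k. d \<in> bits \<rho>' k \<and> d \<notin> bits \<rho>' (Suc k) \<longrightarrow> (i \<in> bits \<rho>' (Suc k)) \<noteq> (j \<in> bits \<rho> (Suc k)))"
    by (cases "\<rho>' d") (simp_all add: bits_def)
qed

section \<open>Configurations as words\<close>

definition enc :: "nat \<Rightarrow> config \<Rightarrow> nat list" where
  "enc n c = map (\<lambda>k. prod_encode (fst c, set_encode (bits (snd c) k))) [0..<n]"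

text \<open>\<open>0 < n\<close> keeps the tag readable when all registers are zero; the other bound
  prevents truncation of a register.\<close>

definition fits :: "nat \<Rightarrow> config \<Rightarrow> bool" where
  "fits n c \<longleftrightarrow> 0 < n \<and> (\<forall>i. snd c i \<le> n)"

definition bounded :: "nat \<Rightarrow> nat \<Rightarrow> config set" where
  "bounded Q M = {(q, \<rho>). q < Q \<and> (\<forall>i\<ge>M. \<rho> i = 0)}"

definition word_rel :: "config rel \<Rightarrow> nat list rel" where
  "word_rel T = {(enc n' c', enc n c) | n' c' n c. (c', c) \<in> T \<and> fits n' c' \<and> fits n c}"

definition letters :: "nat \<Rightarrow> nat \<Rightarrow> nat set" where
  "letters Q M = (\<lambda>(q, X). prod_encode (q, set_encode X)) ` ({..<Q} \<times> Pow {..<M})"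

definition letter_bits :: "nat option \<Rightarrow> nat set" where
  "letter_bits p = (case p of None \<Rightarrow> {} | Some a \<Rightarrow> set_decode (snd (prod_decode a)))"

definition tagged :: "nat \<Rightarrow> nat option \<Rightarrow> bool" where
  "tagged q p \<longleftrightarrow> (case p of None \<Rightarrow> True | Some a \<Rightarrow> fst (prod_decode a) = q)"

definition nth_pad :: "'a list \<Rightarrow> nat \<Rightarrow> 'a option" where
  "nth_pad w k = (if k < length w then Some (w ! k) else None)"

lemma finite_letters: "finite (letters Q M)"
  by (simp add: letters_def)

lemma finite_bits:
  assumes "c \<in> bounded Q M"
  shows "bits (snd c) k \<subseteq> {..<M}" "finite (bits (snd c) k)"
proof -
  show "bits (snd c) k \<subseteq> {..<M}"
    using assms by (force simp: bounded_def bits_def not_less[symmetric])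
  then show "finite (bits (snd c) k)"
    using finite_subset by blast
qed

lemma length_enc [simp]: "length (enc n c) = n"
  by (simp add: enc_def)

lemma enc_in_lists:
  assumes "c \<in> bounded Q M"
  shows "enc n c \<in> lists (letters Q M)"
proof -
  have "prod_encode (fst c, set_encode (bits (snd c) k)) \<in> letters Q M" for k
    unfolding letters_def using finite_bits(1)[OF assms, of k] assms
    by (intro rev_image_eqI[of "(fst c, bits (snd c) k)"]) (auto simp: bounded_def)
  then show ?thesis
    by (auto simp: enc_def)
qed

text \<open>Past the end of the word the empty set is the true column, because no register exceeds
  \<open>n\<close>. Hence padding does not disturb local conditions.\<close>

lemma nth_pad_enc:
  assumes "c \<in> bounded Q M" "fits n c"
  shows "letter_bits (nth_pad (enc n c) k) = bits (snd c) k" "tagged (fst c) (nth_pad (enc n c) k)"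
proof -
  have "bits (snd c) k = {}" if "\<not> k < n"
    using that assms(2) by (auto simp: fits_def bits_def not_less) (meson le_trans leD)
  then show "letter_bits (nth_pad (enc n c) k) = bits (snd c) k"
    using finite_bits[OF assms(1)] by (auto simp: letter_bits_def nth_pad_def enc_def)
  show "tagged (fst c) (nth_pad (enc n c) k)"
    by (simp add: tagged_def nth_pad_def enc_def)
qed

lemma down_closed_nat:
  assumes "\<And>k. P (Suc k) \<Longrightarrow> P k" "\<not> P N"
  shows "\<exists>n. \<forall>k. P k \<longleftrightarrow> k < n"
proof -
  define n where "n = (LEAST k. \<not> P k)"
  have n: "\<not> P n" "\<And>k. k < n \<Longrightarrow> P k"
    unfolding n_def using assms(2) not_less_Least LeastI[of "\<lambda>k. \<not> P k"] by blast+
  have "\<not> P (n + j)" for j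
    using n(1) assms(1) by (induction j) auto
  then have "P k \<longleftrightarrow> k < n" for k
    using n(2)[of k] by (metis le_add_diff_inverse not_le)
  then show ?thesis by blast
qed

text \<open>Converse to \<open>nth_pad_enc\<close>: conditions on adjacent letters characterise
  codes. The positions without padding form an initial segment, whose length is \<open>n\<close>;
  those carrying \<open>i\<close> form one whose length is \<open>\<rho> i\<close>.\<close>

lemma ex_enc:
  fixes p :: "nat \<Rightarrow> nat option"
  assumes "q < Q" "p 0 \<noteq> None" "p N = None" "\<And>k. p k \<in> insert None (Some ` letters Q M)"
    and None: "\<And>k. p k = None \<Longrightarrow> p (Suc k) = None"
    and bits: "\<And>k. letter_bits (p (Suc k)) \<subseteq> letter_bits (p k)"
    and tag: "\<And>k. tagged q (p k)"
  shows "\<exists>n \<rho>. (q, \<rho>) \<in> bounded Q M \<and> fits n (q, \<rho>) \<and> p = nth_pad (enc n (q, \<rho>))"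
proof -
  obtain n where n: "\<And>k. p k \<noteq> None \<longleftrightarrow> k < n"
    using down_closed_nat[of "\<lambda>k. p k \<noteq> None" N] None assms(3) by metis
  have "\<exists>m. \<forall>k. i \<in> letter_bits (p k) \<longleftrightarrow> k < m" for i
    using bits assms(3) by (intro down_closed_nat[where N = N]) (auto simp: letter_bits_def)
  then obtain \<rho> where \<rho>: "\<And>i k. i \<in> letter_bits (p k) \<longleftrightarrow> k < \<rho> i"
    by metis
  have sub: "letter_bits (p k) \<subseteq> {..<M}" for k
  proof -
    have "finite X" if "X \<in> Pow {..<M}" for X
      using that finite_subset by auto
    then show ?thesis
      using assms(4)[of k] by (fastforce simp: letter_bits_def letters_def)
  qed
  have "\<rho> i = 0" if "i \<ge> M" for i
    using \<rho>[of i 0] sub[of 0] that by (meson lessThan_iff not_le subsetD gr_zeroI)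
  then have bd: "(q, \<rho>) \<in> bounded Q M"
    using assms(1) by (simp add: bounded_def)
  have "\<rho> i \<le> n" for i
  proof (rule ccontr)
    assume "\<not> \<rho> i \<le> n"
    then have "i \<in> letter_bits (p n)"
      by (simp add: \<rho>)
    then show False
      using n[of n] by (simp add: letter_bits_def)
  qed
  moreover have "0 < n"
    using n[of 0] assms(2) by simp
  ultimately have ft: "fits n (q, \<rho>)"
    by (simp add: fits_def)
  have "p k = nth_pad (enc n (q, \<rho>)) k" for k
  proof (cases "k < n")
    case True
    then obtain a where a: "p k = Some a"
      using n[of k] by blast
    have "set_decode (snd (prod_decode a)) = bits \<rho> k"
      using \<rho>[of _ k] by (auto simp: a letter_bits_def bits_def)
    moreover have "fst (prod_decode a) = q"
      using tag[of k] by (simp add: a tagged_def)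
    ultimately have "prod_decode a = (q, set_encode (bits \<rho> k))"
      by (metis prod.collapse set_decode_inverse)
    then have "a = prod_encode (q, set_encode (bits \<rho> k))"
      by (metis prod_decode_inverse)
    then show ?thesis
      using True by (simp add: a nth_pad_def enc_def)
  next
    case False
    then show ?thesis
      using n[of k] by (simp add: nth_pad_def)
  qed
  then show ?thesis
    using bd ft by blast
qed

section \<open>Regularity of relations given by local conditions\<close>

lemma convolution_pair:
  "convolution [u, v] = map (\<lambda>k. [nth_pad u k, nth_pad v k]) [0..<max (length u) (length v)]"
  by (simp add: convolution_def nth_pad_def max.commute)

lemma finite_padded_letters:
  assumes "finite \<Sigma>"
  shows "finite (padded_letters \<Sigma> n)"
  unfolding padded_letters_def
  using finite_lists_length_eq[of "insert None (Some ` \<Sigma>)" n] assms by (simp add: conj_commute)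

text \<open>The pair of tags is constant along the two words and serves as the mode of
  \<open>regular_local\<close>. The remaining conditions, those of \<open>ex_enc\<close> and those
  of \<open>F\<close> and \<open>D\<close>, concern first or adjacent letters.\<close>

lemma regular_rel_word_rel:
  assumes "\<And>q' q. local_rel (S q' q)"
    and T: "T = {((q', \<rho>'), (q, \<rho>)). (q', \<rho>') \<in> bounded Q M \<and> (q, \<rho>) \<in> bounded Q M \<and> S q' q \<rho>' \<rho>}"
  shows "regular_rel (letters Q M) 2 (tuples (word_rel T))"
proof -
  obtain F D where FD: "\<And>q' q \<rho>' \<rho>. S q' q \<rho>' \<rho> \<longleftrightarrow> F q' q (bits \<rho>' 0) (bits \<rho> 0) \<and>
     (\<forall>k. D q' q (bits \<rho>' k) (bits \<rho> k) (bits \<rho>' (Suc k)) (bits \<rho> (Suc k)))"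
    using assms(1) unfolding local_rel_def by metis
  define e :: "nat option list" where "e = [None, None]"
  define Fm where "Fm \<theta> \<sigma> \<longleftrightarrow> \<sigma> ! 0 \<noteq> None \<and> \<sigma> ! 1 \<noteq> None \<and>
      F (fst \<theta>) (snd \<theta>) (letter_bits (\<sigma> ! 0)) (letter_bits (\<sigma> ! 1))" for \<theta> \<sigma>
  \<comment> \<open>\<open>\<sigma> \<noteq> e\<close> excludes the all-padding letter, which lies
    in the alphabet but in no convolution. The last conjunct stands for all positions past the ends
    of both words.\<close>
  define Dm where "Dm \<theta> \<sigma> \<tau> \<longleftrightarrow> \<sigma> \<noteq> e \<and> tagged (fst \<theta>) (\<sigma> ! 0) \<and> tagged (snd \<theta>) (\<sigma> ! 1) \<and>
      (\<sigma> ! 0 = None \<longrightarrow> \<tau> ! 0 = None) \<and> (\<sigma> ! 1 = None \<longrightarrow> \<tau> ! 1 = None) \<and>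
      letter_bits (\<tau> ! 0) \<subseteq> letter_bits (\<sigma> ! 0) \<and> letter_bits (\<tau> ! 1) \<subseteq> letter_bits (\<sigma> ! 1) \<and>
      D (fst \<theta>) (snd \<theta>) (letter_bits (\<sigma> ! 0)) (letter_bits (\<sigma> ! 1))
        (letter_bits (\<tau> ! 0)) (letter_bits (\<tau> ! 1)) \<and>
      D (fst \<theta>) (snd \<theta>) {} {} {} {}" for \<theta> \<sigma> \<tau>
  define \<Gamma> where "\<Gamma> = padded_letters (letters Q M) 2"
  define L where "L = {w \<in> lists \<Gamma>. w \<noteq> [] \<and> (\<exists>\<theta>\<in>{..<Q} \<times> {..<Q}. Fm \<theta> (hd w) \<and>
    (\<forall>k<length w. Dm \<theta> (w ! k) (if Suc k < length w then w ! Suc k else e)))}"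
  have "regular \<Gamma> L"
    unfolding L_def by (rule regular_local) (simp_all add: \<Gamma>_def finite_padded_letters finite_letters)
  moreover have "convolution ` tuples (word_rel T) \<subseteq> L"
  proof clarify
    fix ws
    assume "ws \<in> tuples (word_rel T)"
    then obtain n' q' \<rho>' n q \<rho> where ws: "ws = [enc n' (q', \<rho>'), enc n (q, \<rho>)]"
      and T': "((q', \<rho>'), (q, \<rho>)) \<in> T" and fits: "fits n' (q', \<rho>')" "fits n (q, \<rho>)"
      by (auto simp: tuples_def word_rel_def)
    have bd: "(q', \<rho>') \<in> bounded Q M" "(q, \<rho>) \<in> bounded Q M" and S: "S q' q \<rho>' \<rho>"
      using T' by (auto simp: T)
    let ?u = "enc n' (q', \<rho>')" and ?v = "enc n (q, \<rho>)"
    define w where "w = convolution ws"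
    have len: "length w = max n' n"
      by (simp add: w_def ws convolution_pair)
    have W: "(if k < length w then w ! k else e) = [nth_pad ?u k, nth_pad ?v k]" for k
      by (simp add: len) (auto simp: w_def ws convolution_pair e_def nth_pad_def)
    have pos: "0 < n'" "0 < n"
      using fits by (simp_all add: fits_def)
    then have "w \<noteq> []"
      using len by auto
    then have hd: "hd w = [nth_pad ?u 0, nth_pad ?v 0]"
      using W[of 0] by (simp add: hd_conv_nth)
    have lb: "letter_bits (nth_pad ?u k) = bits \<rho>' k" "letter_bits (nth_pad ?v k) = bits \<rho> k"
      "tagged q' (nth_pad ?u k)" "tagged q (nth_pad ?v k)" for k
      using nth_pad_enc[OF bd(1) fits(1)] nth_pad_enc[OF bd(2) fits(2)] by simp_all
    have "w \<in> lists \<Gamma>"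
      using enc_in_lists[OF bd(1), of n'] enc_in_lists[OF bd(2), of n]
      by (auto simp: w_def ws convolution_pair \<Gamma>_def padded_letters_def nth_pad_def in_lists_conv_set)
    moreover have "Fm (q', q) (hd w)"
      using S pos lb[of 0] by (simp add: Fm_def hd FD) (simp add: nth_pad_def)
    moreover have "Dm (q', q) (w ! k) (if Suc k < length w then w ! Suc k else e)"
      if "k < length w" for k
    proof -
      \<comment> \<open>At position \<open>max n' n\<close> all columns involved are empty, so the
        instance of \<open>D\<close> there yields the last conjunct of \<open>Dm\<close>.\<close>
      have "bits \<rho>' (max n' n) = {}" "bits \<rho> (max n' n) = {}"
        "bits \<rho>' (Suc (max n' n)) = {}" "bits \<rho> (Suc (max n' n)) = {}"
        using fits by (auto simp: bits_def fits_def not_less le_SucI max.coboundedI1 max.coboundedI2)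
      then have "D q' q {} {} {} {}"
        using S[unfolded FD] by metis
      moreover have "w ! k = [nth_pad ?u k, nth_pad ?v k]"
        using W[of k] that by simp
      moreover have "[nth_pad ?u k, nth_pad ?v k] \<noteq> e"
        using that len by (auto simp: e_def nth_pad_def)
      moreover have "bits \<rho>' (Suc k) \<subseteq> bits \<rho>' k" "bits \<rho> (Suc k) \<subseteq> bits \<rho> k"
        by (auto simp: bits_def)
      ultimately show ?thesis
        unfolding W[of "Suc k"] Dm_def using S[unfolded FD] lb
        by (auto simp: nth_pad_def)
    qed
    moreover have "(q', q) \<in> {..<Q} \<times> {..<Q}"
      using bd by (simp add: bounded_def)
    ultimately show "convolution ws \<in> L"
      unfolding L_def w_def[symmetric] using \<open>w \<noteq> []\<close> by blast
  qed
  moreover have "L \<subseteq> convolution ` tuples (word_rel T)"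
  proof
    fix w
    assume "w \<in> L"
    then obtain q' q where w: "w \<in> lists \<Gamma>" "w \<noteq> []" "q' < Q" "q < Q" "Fm (q', q) (hd w)"
      and Dm: "\<And>k. k < length w \<Longrightarrow>
        Dm (q', q) (w ! k) (if Suc k < length w then w ! Suc k else e)"
      unfolding L_def by auto
    define W where "W k = (if k < length w then w ! k else e)" for k
    define p' where "p' k = W k ! 0" for k
    define p where "p k = W k ! 1" for k
    have "length \<sigma> = 2 \<and> set \<sigma> \<subseteq> insert None (Some ` letters Q M)" if "\<sigma> \<in> set w" for \<sigma>
      using w(1) that by (auto simp: \<Gamma>_def padded_letters_def)
    then have *: "length (W k) = 2 \<and> set (W k) \<subseteq> insert None (Some ` letters Q M)" for k
      by (simp add: W_def e_def)
    have Weq: "W k = [p' k, p k]" for k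
      using *[of k] by (auto simp: p'_def p_def length_Suc_conv numeral_2_eq_2)
    have letters: "p' k \<in> insert None (Some ` letters Q M)" "p k \<in> insert None (Some ` letters Q M)" for k
      using *[of k] unfolding Weq by simp_all
    have DW: "Dm (q', q) (W k) (W (Suc k))" if "k < length w" for k
      using Dm[OF that] that by (simp add: W_def)
    have out: "p' k = None \<and> p k = None \<longleftrightarrow> \<not> k < length w" for k
    proof (cases "k < length w")
      case True
      then show ?thesis
        using DW[of k] unfolding Dm_def Weq e_def by simp
    next
      case False
      then show ?thesis
        using Weq[of k] unfolding W_def e_def by simp
    qed
    have mono: "(p' k = None \<longrightarrow> p' (Suc k) = None) \<and> (p k = None \<longrightarrow> p (Suc k) = None) \<and>
        letter_bits (p' (Suc k)) \<subseteq> letter_bits (p' k) \<and> letter_bits (p (Suc k)) \<subseteq> letter_bits (p k) \<and>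
        tagged q' (p' k) \<and> tagged q (p k)" for k
    proof (cases "k < length w")
      case True
      then show ?thesis
        using DW[of k] unfolding Dm_def Weq by simp
    next
      case False
      then show ?thesis
        using out[of k] out[of "Suc k"] by (simp add: letter_bits_def tagged_def)
    qed
    have "hd w = W 0"
      using w(2) by (simp add: W_def hd_conv_nth)
    then have F0: "p' 0 \<noteq> None" "p 0 \<noteq> None" "F q' q (letter_bits (p' 0)) (letter_bits (p 0))"
      using w(5) unfolding Fm_def Weq by simp_all
    have pN: "p' (length w) = None" "p (length w) = None"
      using out[of "length w"] by simp_all
    obtain n' \<rho>' where u: "(q', \<rho>') \<in> bounded Q M" "fits n' (q', \<rho>')" "p' = nth_pad (enc n' (q', \<rho>'))"
      using ex_enc[OF w(3) F0(1) pN(1) letters(1)] mono by blast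
    obtain n \<rho> where v: "(q, \<rho>) \<in> bounded Q M" "fits n (q, \<rho>)" "p = nth_pad (enc n (q, \<rho>))"
      using ex_enc[OF w(4) F0(2) pN(2) letters(2)] mono by blast
    have lb: "letter_bits (p' k) = bits \<rho>' k" "letter_bits (p k) = bits \<rho> k" for k
      using nth_pad_enc(1)[OF u(1,2), of k] nth_pad_enc(1)[OF v(1,2), of k] by (simp_all add: u(3) v(3))
    have "D q' q (bits \<rho>' k) (bits \<rho> k) (bits \<rho>' (Suc k)) (bits \<rho> (Suc k))" for k
    proof (cases "k < length w")
      case True
      then show ?thesis
        using DW[of k] unfolding Dm_def Weq by (simp add: lb)
    next
      case False
      then have "bits \<rho>' k = {}" "bits \<rho> k = {}" "bits \<rho>' (Suc k) = {}" "bits \<rho> (Suc k) = {}"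
        using out[of k] out[of "Suc k"] by (simp_all add: lb[symmetric] letter_bits_def)
      then show ?thesis
        using DW[of 0] w(2) unfolding Dm_def by simp
    qed
    then have "S q' q \<rho>' \<rho>"
      using F0(3) by (simp add: FD lb)
    then have "((q', \<rho>'), (q, \<rho>)) \<in> T"
      using u v by (simp add: T)
    then have R: "(enc n' (q', \<rho>'), enc n (q, \<rho>)) \<in> word_rel T"
      unfolding word_rel_def using u v by blast
    have "k < length w \<longleftrightarrow> k < max n' n" for k
      using out[of k] by (auto simp: u(3) v(3) nth_pad_def split: if_splits)
    then have len: "length w = max n' n"
      by (subst nat_eq_iff_less) blast
    have "w ! k = [p' k, p k]" if "k < length w" for k
      using Weq[of k] that by (simp add: W_def)
    then have "w = convolution [enc n' (q', \<rho>'), enc n (q, \<rho>)]"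
      by (intro nth_equalityI) (simp_all add: convolution_pair len u(3) v(3))
    then show "w \<in> convolution ` tuples (word_rel T)"
      using R by (auto simp: tuples_def)
  qed
  ultimately have "regular \<Gamma> (convolution ` tuples (word_rel T))"
    by (metis subset_antisym)
  moreover have "tuples (word_rel T) \<subseteq> {ws. length ws = 2 \<and> set ws \<subseteq> lists (letters Q M)}"
    by (auto simp: tuples_def word_rel_def T intro: subsetD[OF _ enc_in_lists] dest!: enc_in_lists)
  ultimately show ?thesis
    by (simp add: regular_rel_def \<Gamma>_def)
qed

text \<open>Taking all words as the domain makes it trivially regular; words that code no
  configuration are merely isolated elements.\<close>

lemma automatic_word_rel:
  assumes "\<And>q' q. local_rel (S q' q)"
    and T: "T = {((q', \<rho>'), (q, \<rho>)). (q', \<rho>') \<in> bounded Q M \<and> (q, \<rho>) \<in> bounded Q M \<and> S q' q \<rho>' \<rho>}"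
  shows "automatic (lists (letters Q M)) [(2, tuples (word_rel T))]"
proof -
  have "regular_rel (letters Q M) 2 (tuples (word_rel T))"
    using assms by (rule regular_rel_word_rel)
  then show ?thesis
    unfolding automatic_def
    by (intro exI[of _ "letters Q M"]) (simp add: finite_letters regular_lists regular_rel_def)
qed

section \<open>Transfer of well-foundedness and of chains to words\<close>

lemma wf_word_rel:
  assumes "wf T" "T \<subseteq> bounded Q M \<times> bounded Q M"
  shows "wf (word_rel T)"
proof -
  \<comment> \<open>Decoding forgets the padding: the tag comes from the first letter, and a
    register counts the marks on its track.\<close>
  define dec where "dec w = (fst (prod_decode (w ! 0)),
      \<lambda>i. card {k. i \<in> letter_bits (nth_pad w k)})" for w
  have "dec (enc n c) = c" if "c \<in> bounded Q M" "fits n c" for n c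
  proof (rule prod_eqI)
    show "fst (dec (enc n c)) = fst c"
      using that(2) by (simp add: dec_def enc_def fits_def)
    have "{k. i \<in> bits (snd c) k} = {..<snd c i}" for i
      by (auto simp: bits_def)
    then show "snd (dec (enc n c)) = snd c"
      by (simp add: dec_def nth_pad_enc(1)[OF that])
  qed
  then have "word_rel T \<subseteq> inv_image T dec"
    using assms(2) by (fastforce simp: word_rel_def)
  then show ?thesis
    using wf_subset[OF wf_inv_image[OF assms(1)]] by blast
qed

lemma ex_fits:
  assumes "c \<in> bounded Q M"
  shows "\<exists>n. fits n c"
proof -
  have "snd c i \<le> Suc (sum (snd c) {..<M})" for i
    using assms member_le_sum[of i "{..<M}" "snd c"]
    by (cases "i < M") (auto simp: bounded_def)
  then show ?thesis
    unfolding fits_def by blast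
qed

definition code :: "config \<Rightarrow> nat list" where
  "code c = enc (SOME n. fits n c) c"

text \<open>One fixed choice of lengths turns chains in \<open>T\<close> into chains of words, which
  is what lower bounds on ranks need.\<close>

lemma code_trancl:
  assumes "T \<subseteq> bounded Q M \<times> bounded Q M" "(c, d) \<in> T\<^sup>+"
  shows "(code c, code d) \<in> (word_rel T)\<^sup>+"
proof -
  have fits: "fits (SOME n. fits n c) c" if "c \<in> bounded Q M" for c
    using ex_fits[OF that] by (rule someI_ex)
  have *: "(code c, code d) \<in> word_rel T" if "(c, d) \<in> T" for c d
  proof -
    have "fits (SOME n. fits n c) c" "fits (SOME n. fits n d) d"
      using that assms(1) fits by blast+
    then show ?thesis
      unfolding code_def word_rel_def using that by blast
  qed
  show ?thesis
    using assms(2)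
  proof (induction rule: trancl_induct)
    case (base d)
    then show ?case
      using * by (intro r_into_trancl) simp
  next
    case (step d d')
    then show ?case
      using *[of d d'] by (simp add: trancl_into_trancl)
  qed
qed


section \<open>Ranks and order types\<close>

text \<open>Over a countable type the supremum defining the rank is taken over a countable set,
  hence is a genuine upper bound.\<close>

lemma ordinal_rank_less:
  fixes R :: "'a :: countable rel"
  assumes "wf R" "(y, z) \<in> R"
  shows "ordinal_rank R y < ordinal_rank R z"
proof -
  have "countable {succ_ord (ordinal_rank R y) | y. (y, z) \<in> R}"
    by (rule countable_subset[of _ "range (\<lambda>y. succ_ord (ordinal_rank R y))"]) auto
  then have "succ_ord (ordinal_rank R y) \<le> ordinal_rank R z"
    unfolding ordinal_rank_eq[OF assms(1), of z] using assms(2) by (intro sup_ord_upper) auto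
  then show ?thesis
    using succ_ord_greater less_le_trans by blast
qed

lemma ordinal_rank_less_trancl:
  fixes R :: "'a :: countable rel"
  assumes "wf R" "(y, z) \<in> R\<^sup>+"
  shows "ordinal_rank R y < ordinal_rank R z"
  using assms(2)
  by (induction rule: trancl_induct) (blast intro: ordinal_rank_less[OF assms(1)] less_trans)+

lemma ordinal_rank_le_height:
  fixes R :: "'a :: countable rel"
  assumes "x \<in> A"
  shows "ordinal_rank R x \<le> ordinal_height A R"
  unfolding ordinal_height_def using assms by (intro sup_ord_upper) auto

lemma ordtype_less_iff:
  assumes "Well_order r" "Well_order s"
  shows "ordtype r < ordtype s \<longleftrightarrow> r <o s"
  using assms by (simp add: less_cord.abs_eq ordIso_reflexive)

lemma ordtype_less_ordtype_obtain:
  assumes "Well_order r" "b < ordtype r"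
  obtains x where "x \<in> Field r" "b = ordtype (Restr r (underS r x))"
proof -
  have rep: "rep_cord b =o rep_cord b"
    by (rule Quotient3_rep_reflp[OF Quotient3_cord])
  then have wo: "Well_order (rep_cord b)"
    by (simp add: ordIso_def)
  have b: "b = ordtype (rep_cord b)"
    by (simp add: Quotient3_abs_rep[OF Quotient3_cord])
  have "rep_cord b <o r"
    using assms b ordtype_less_iff[OF wo assms(1)] by simp
  then obtain x where x: "x \<in> Field r" "rep_cord b =o Restr r (underS r x)"
    using ordLess_iff_ordIso_Restr[OF assms(1) wo] by blast
  then have "ordtype (rep_cord b) = ordtype (Restr r (underS r x))"
    using Quotient3_rel[OF Quotient3_cord] by metis
  then show ?thesis
    using that x b by simp
qed

text \<open>Strict monotonicity forces the type of the segment below \<open>x\<close> to be at most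
  \<open>h x\<close>. If \<open>b\<close> were smaller than the type of \<open>r\<close>, it would
  be the type of such a segment, giving \<open>b \<le> h x < b\<close>.\<close>

lemma ordtype_le_strict_bound:
  fixes h :: "nat \<Rightarrow> cord"
  assumes r: "Well_order r" and h: "\<And>x y. (y, x) \<in> r - Id \<Longrightarrow> h y < h x"
    and b: "\<And>x. x \<in> Field r \<Longrightarrow> h x < b"
  shows "ordtype r \<le> b"
proof -
  define seg where "seg x = Restr r (underS r x)" for x
  have seg: "Well_order (seg x)" for x
    unfolding seg_def by (rule Well_order_Restr[OF r])
  have seg_less: "ordtype (seg x) < ordtype r" if "x \<in> Field r" for x
    using that ordtype_less_iff[OF seg r] underS_Restr_ordLess[OF r] unfolding seg_def by fastforce
  have seg_mono: "(y, x) \<in> r - Id"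
    if xy: "x \<in> Field r" "y \<in> Field r" and less: "ordtype (seg y) < ordtype (seg x)" for x y
  proof (rule ccontr)
    assume "(y, x) \<notin> r - Id"
    then have "(x, y) \<in> r"
      using xy r unfolding order_on_defs total_on_def refl_on_def by (cases "x = y") auto
    then have "underS r x \<subseteq> underS r y"
      using r unfolding order_on_defs underS_def by (auto dest: transD antisymD)
    then have "seg x \<le>o seg y"
      unfolding seg_def using ofilter_subset_ordLeq[OF r] wo_rel.underS_ofilter[of r] r
      by (simp add: wo_rel_def)
    then have "\<not> seg y <o seg x"
      using not_ordLess_ordLeq by blast
    then show False
      using less ordtype_less_iff[OF seg seg] by blast
  qed
  have le: "\<forall>x\<in>Field r. ordtype (seg x) = a \<longrightarrow> a \<le> h x" for a
  \<comment> \<open>For a counterexample \<open>x\<close>, the ordinal \<open>h x\<close> is the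
    type of the segment at some \<open>y\<close> below \<open>x\<close>. The induction hypothesis at
    \<open>h x\<close> gives \<open>h x \<le> h y\<close>, against \<open>h y < h x\<close>.\<close>
  proof (induction a rule: less_induct)
    case (less a)
    show ?case
    proof (intro ballI impI, rule ccontr)
      fix x
      assume x: "x \<in> Field r" "ordtype (seg x) = a" "\<not> a \<le> h x"
      then have "h x < ordtype r"
        using seg_less[OF x(1)] by (metis less_trans not_le)
      then obtain y where y: "y \<in> Field r" "h x = ordtype (seg y)"
        using ordtype_less_ordtype_obtain[OF r] unfolding seg_def by metis
      then have "h x \<le> h y"
        using less.IH[of "h x"] x(3) by auto
      moreover have "h y < h x"
        using h[OF seg_mono[OF x(1) y(1)]] x y by simp
      ultimately show False by simp
    qed
  qed
  show ?thesis
  proof (rule ccontr)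
    assume "\<not> ordtype r \<le> b"
    then obtain x where "x \<in> Field r" "b = ordtype (seg x)"
      using ordtype_less_ordtype_obtain[OF r] unfolding seg_def by (metis not_le)
    then show False
      using le b[of x] by (metis leD)
  qed
qed


section \<open>The descent through a computable well-order\<close>

fun reg :: "instr \<Rightarrow> nat" where
  "reg (Inc i) = i"
| "reg (Dec i l) = i"

text \<open>\<open>step\<close> fixes halted configurations, so \<open>n\<close> only bounds the
  running time from above.\<close>

definition accepts_in :: "prog \<Rightarrow> nat \<Rightarrow> config \<Rightarrow> bool" where
  "accepts_in P n c \<longleftrightarrow> halted P ((step P ^^ n) c) \<and> snd ((step P ^^ n) c) 0 = 1"

locale order_machine =
  fixes P :: prog and K :: nat and r :: "nat rel"
  assumes wo: "Well_order r"
    and K: "2 \<le> K"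
    and reg_less: "\<And>a. a \<in> set P \<Longrightarrow> reg a < K"
    and comp: "\<And>x y. computes P [x, y] (if (x, y) \<in> r then 1 else 0)"
begin

text \<open>
  Registers from \<open>K\<close> on are not touched by \<open>P\<close>: \<open>K\<close> keeps the guessed number (in start
  configurations, the current one), \<open>K + 1\<close> is the clock, and \<open>K + 2\<close> witnesses that the guess differs
  from the current number. The tags \<open>length P\<close>, \<open>length P + 1\<close> and \<open>length P + 2\<close>, \<open>length P + 3\<close>
  stand for halted, start and the two top elements; jumps out of the program are cut to
  \<open>length P\<close>. The primed configuration is the lower one. Registers that are not mentioned are
  arbitrary.
\<close>

definition trans :: "nat \<Rightarrow> nat \<Rightarrow> (nat \<Rightarrow> nat) \<Rightarrow> (nat \<Rightarrow> nat) \<Rightarrow> bool" where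
  "trans q' q \<rho>' \<rho> =
    (if q < length P then q' = min (fst (exec (P ! q) (q, \<rho>))) (length P) \<and>
       (\<forall>j\<in>{..K}. \<rho>' j = snd (exec (P ! q) (q, \<rho>)) j) \<and> \<rho> (K + 1) = Suc (\<rho>' (K + 1))
     else if q = length P then q' = length P + 1 \<and> \<rho> 0 = 1 \<and> \<rho>' K = \<rho> K
     else if q = length P + 1 then q' = 0 \<and> \<rho>' 0 = \<rho>' K \<and> \<rho>' 1 = \<rho> K \<and> (\<forall>j\<in>{2..<K}. \<rho>' j = 0) \<and>
       (\<rho>' (K + 2) < \<rho>' K) \<noteq> (\<rho>' (K + 2) < \<rho> K)
     else q' = q - 1)"

abbreviation confs :: "config set" where
  "confs \<equiv> bounded (length P + 4) (K + 3)"

definition T :: "config rel" where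
  "T = {((q', \<rho>'), (q, \<rho>)). (q', \<rho>') \<in> confs \<and> (q, \<rho>) \<in> confs \<and> trans q' q \<rho>' \<rho>}"

lemma T_subset: "T \<subseteq> confs \<times> confs"
  by (auto simp: T_def)

text \<open>Once the tags are fixed, so is the instruction, and each case is a conjunction of the
  local conditions above.\<close>

lemma local_rel_trans: "local_rel (trans q' q)"
proof (cases "q < length P")
  case True
  have fst: "local_rel (\<lambda>\<rho>' \<rho>. q' = min (fst (exec (P ! q) (q, \<rho>))) (length P))"
  proof (cases "P ! q")
    case (Inc i)
    then show ?thesis by (simp add: local_rel_const)
  next
    case (Dec i l)
    then show ?thesis
      using local_rel_first[of "\<lambda>b. q' = min (if b then l else Suc q) (length P)" i]
      by (simp add: if_distrib[of fst] cong: if_cong)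
  qed
  have snd: "local_rel (\<lambda>\<rho>' \<rho>. \<rho>' j = snd (exec (P ! q) (q, \<rho>)) j)" for j
  proof (cases "P ! q")
    case (Inc i)
    then show ?thesis by (cases "j = i") (simp_all add: local_rel_Suc local_rel_eq)
  next
    case (Dec i l)
    \<comment> \<open>Truncated subtraction covers the zero branch as well, so the register update
      needs no zero test.\<close>
    have "snd (exec (Dec i l) (q, \<rho>)) j = (if j = i then \<rho> j - 1 else \<rho> j)" for \<rho>
      by simp
    then show ?thesis
      unfolding Dec using local_rel_pred local_rel_eq by (cases "j = i") simp_all
  qed
  show ?thesis
    unfolding trans_def[abs_def] using True
    by (simp only: if_True) (intro local_rel_conj local_rel_Ball fst snd local_rel_eq_Suc)
next
  case False
  then consider "q = length P" | "q = length P + 1" | "q > length P + 1"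
    by linarith
  then show ?thesis
  proof cases
    case 1
    have "local_rel (\<lambda>\<rho>' \<rho>. q' = length P + 1 \<and> \<rho> 0 = 1 \<and> \<rho>' K = \<rho> K)"
      by (intro local_rel_conj local_rel_const local_rel_one local_rel_eq)
    then show ?thesis
      by (simp add: trans_def[abs_def] 1)
  next
    case 2
    have "local_rel (\<lambda>\<rho>' \<rho>. q' = 0 \<and> \<rho>' 0 = \<rho>' K \<and> \<rho>' 1 = \<rho> K \<and> (\<forall>j\<in>{2..<K}. \<rho>' j = 0) \<and>
       (\<rho>' (K + 2) < \<rho>' K) \<noteq> (\<rho>' (K + 2) < \<rho> K))"
      by (intro local_rel_conj local_rel_Ball local_rel_const local_rel_eq local_rel_eq_left
          local_rel_zero local_rel_differ)
    then show ?thesis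
      by (simp add: trans_def[abs_def] 2)
  next
    case 3
    then show ?thesis
      by (simp add: trans_def[abs_def] local_rel_const)
  qed
qed

section \<open>Machine runs up to the bookkeeping registers\<close>

lemma accepts_in_initial: "(\<exists>n. accepts_in P n (initial [y, x])) \<longleftrightarrow> (y, x) \<in> r"
proof -
  have "(\<exists>n. accepts_in P n (initial [y, x])) \<longleftrightarrow> computes P [y, x] 1"
    by (simp add: accepts_in_def computes_def)
  also have "\<dots> \<longleftrightarrow> (y, x) \<in> r"
    using comp[of y x] computes_unique[of P "[y, x]" 1 0] by (cases "(y, x) \<in> r") auto
  finally show ?thesis .
qed

text \<open>What a run can see: all counters outside the program are identified, since
  \<open>trans\<close> cuts jumps, and the bookkeeping registers from \<open>K\<close> on are
  ignored.\<close>

definition agree :: "config \<Rightarrow> config \<Rightarrow> bool" where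
  "agree c d \<longleftrightarrow> min (fst c) (length P) = min (fst d) (length P) \<and> (\<forall>j<K. snd c j = snd d j)"

lemma agree_step:
  assumes "agree c d"
  shows "agree (step P c) (step P d)"
proof (cases "fst c < length P")
  case True
  then have "fst d = fst c"
    using assms by (simp add: agree_def min_def split: if_splits)
  then obtain q \<rho> \<rho>' where cd: "c = (q, \<rho>)" "d = (q, \<rho>')"
    by (metis prod.collapse)
  have regs: "\<rho> j = \<rho>' j" if "j < K" for j
    using assms that by (simp add: agree_def cd)
  have "q < length P" "reg (P ! q) < K"
    using True by (simp_all add: reg_less cd)
  then show ?thesis
    by (cases "P ! q") (simp_all add: agree_def step_def halted_def cd regs)
next
  case False
  then have "\<not> fst d < length P"
    using assms by (simp add: agree_def min_def split: if_splits)
  then show ?thesis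
    using False assms by (simp add: step_def halted_def)
qed

lemma accepts_in_agree:
  assumes "agree c d" "accepts_in P n c"
  shows "accepts_in P n d"
proof -
  have "agree ((step P ^^ n) c) ((step P ^^ n) d)"
    by (induction n) (simp_all add: assms(1) agree_step)
  then show ?thesis
    using assms(2) K by (auto simp: accepts_in_def agree_def halted_def min_def split: if_splits)
qed

lemma accepts_in_Suc: "accepts_in P (Suc n) c \<longleftrightarrow> accepts_in P n (step P c)"
  by (simp add: accepts_in_def funpow_swap1)

lemma accepts_in_halted:
  assumes "length P \<le> q"
  shows "accepts_in P n (q, \<rho>) \<longleftrightarrow> \<rho> 0 = 1"
proof -
  have "(step P ^^ n) (q, \<rho>) = (q, \<rho>)"
    using assms by (induction n) (simp_all add: step_def halted_def)
  then show ?thesis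
    using assms by (simp add: accepts_in_def halted_def)
qed

lemma trans_step_agree:
  assumes "q < length P" "trans q' q \<rho>' \<rho>"
  shows "agree (q', \<rho>') (step P (q, \<rho>))"
  using assms by (auto simp: trans_def agree_def step_def halted_def)

lemma exec_reg_ge:
  assumes "q < length P" "K \<le> j"
  shows "snd (exec (P ! q) (q, \<rho>)) j = \<rho> j"
proof -
  have "reg (P ! q) < K"
    using assms(1) by (simp add: reg_less)
  then show ?thesis
    using assms(2) by (cases "P ! q") auto
qed

text \<open>Leaving a start configuration enters the machine on the guess and the current number, so
  the run decides whether the guess is \<open>r\<close>-below.\<close>

lemma trans_start_agree:
  assumes "trans q' (length P + 1) \<rho>' \<rho>"
  shows "agree (q', \<rho>') (initial [\<rho>' K, \<rho> K])"
proof -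
  have t: "q' = 0" "\<rho>' 0 = \<rho>' K" "\<rho>' 1 = \<rho> K" "\<And>j. 2 \<le> j \<Longrightarrow> j < K \<Longrightarrow> \<rho>' j = 0"
    using assms by (simp_all add: trans_def)
  have "\<rho>' j = snd (initial [\<rho>' K, \<rho> K]) j" if "j < K" for j
  proof -
    consider "j = 0" | "j = 1" | "2 \<le> j"
      by linarith
    then show ?thesis
      using t that by cases (simp_all add: initial_def)
  qed
  then show ?thesis
    by (simp add: agree_def t(1)) (simp add: initial_def)
qed

section \<open>Well-foundedness of \<open>T\<close>\<close>

definition start_acc :: "nat \<Rightarrow> bool" where
  "start_acc x \<longleftrightarrow> (\<forall>\<rho>. \<rho> K = x \<longrightarrow> (length P + 1, \<rho>) \<in> Wellfounded.acc T)"

text \<open>The clock bounds every run, including those from configurations that no start reaches; so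
  only the start configurations that a run can end in matter.\<close>

lemma run_acc:
  assumes "q \<le> length P" "\<And>n. accepts_in P n (q, \<rho>) \<Longrightarrow> start_acc (\<rho> K)"
  shows "(q, \<rho>) \<in> Wellfounded.acc T"
  using assms
proof (induction "\<rho> (K + 1)" arbitrary: q \<rho> rule: less_induct)
  case less
  show ?case
  proof (rule Wellfounded.accI)
    fix c
    assume "(c, (q, \<rho>)) \<in> T"
    then obtain q' \<rho>' where c: "c = (q', \<rho>')" and t: "trans q' q \<rho>' \<rho>"
      by (auto simp: T_def)
    show "c \<in> Wellfounded.acc T"
    proof (cases "q < length P")
      case True
      have K': "\<rho>' K = \<rho> K"
        using t True exec_reg_ge[OF True, of K] by (simp add: trans_def)
      \<comment> \<open>Acceptance from the successor within \<open>n\<close> steps is acceptance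
        from here within \<open>Suc n\<close>, so the premise passes on.\<close>
      have "start_acc (\<rho>' K)" if "accepts_in P n (q', \<rho>')" for n
        using less.prems(2)[of "Suc n"] accepts_in_agree[OF trans_step_agree[OF True t] that] K'
        by (simp add: accepts_in_Suc)
      moreover have "\<rho>' (K + 1) < \<rho> (K + 1)" "q' \<le> length P"
        using t True by (simp_all add: trans_def)
      ultimately show ?thesis
        unfolding c using less.hyps by blast
    next
      case False
      then have "q' = length P + 1" "\<rho> 0 = 1" "\<rho>' K = \<rho> K"
        using t less.prems(1) by (auto simp: trans_def)
      then show ?thesis
        using less.prems(2)[of 0] less.prems(1) False accepts_in_halted[of q 0 \<rho>]
        by (simp add: c start_acc_def)
    qed
  qed
qed

text \<open>Induction along \<open>r - Id\<close>: an accepting run shows that the guess is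
  \<open>r\<close>-below \<open>x\<close>, and the witness register that it differs from
  \<open>x\<close>. For a run that does not accept, the premise of \<open>run_acc\<close> is
  vacuous.\<close>

lemma start_acc: "start_acc x"
proof -
  have "wf (r - Id)"
    using wo by (simp add: well_order_on_def)
  then show ?thesis
  proof (induction x rule: wf_induct_rule)
    case (less x)
    show ?case
      unfolding start_acc_def
    proof (intro allI impI, rule Wellfounded.accI)
      fix \<rho> c
      assume x: "\<rho> K = x" and "(c, (length P + 1, \<rho>)) \<in> T"
      then obtain q' \<rho>' where c: "c = (q', \<rho>')" and t: "trans q' (length P + 1) \<rho>' \<rho>"
        by (auto simp: T_def)
      have "start_acc (\<rho>' K)" if "accepts_in P n (q', \<rho>')" for n
      proof -
        have "(\<rho>' K, x) \<in> r"
          using accepts_in_agree[OF trans_start_agree[OF t] that] accepts_in_initial x by blast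
        moreover have "\<rho>' K \<noteq> x"
          using t x by (auto simp: trans_def)
        ultimately show ?thesis
          using less by blast
      qed
      moreover have "q' = 0"
        using t by (simp add: trans_def)
      ultimately show "c \<in> Wellfounded.acc T"
        unfolding c using run_acc by blast
    qed
  qed
qed

lemma wf_T: "wf T"
proof -
  have low: "(q, \<rho>) \<in> Wellfounded.acc T" if "q \<le> length P + 1" for q \<rho>
  proof (cases "q = length P + 1")
    case True
    then show ?thesis
      using start_acc[of "\<rho> K", unfolded start_acc_def, THEN spec, of \<rho>] by simp
  next
    case False
    then show ?thesis
      using that by (simp add: run_acc start_acc)
  qed
  \<comment> \<open>Above the start tag each step just lowers the tag by one, so induction on the
    tag reaches \<open>low\<close>.\<close>
  have all: "(q, \<rho>) \<in> Wellfounded.acc T" for q \<rho>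
  proof (induction q arbitrary: \<rho>)
    case 0
    then show ?case by (simp add: low)
  next
    case (Suc q)
    show ?case
    proof (cases "Suc q \<le> length P + 1")
      case False
      then have "\<exists>\<rho>'. c = (q, \<rho>')" if "(c, (Suc q, \<rho>)) \<in> T" for c
        using that by (auto simp: T_def trans_def)
      then show ?thesis
        using Suc.IH Wellfounded.accI by metis
    qed (simp add: low)
  qed
  have "\<forall>c. c \<in> Wellfounded.acc T"
    by (simp add: split_paired_All all)
  then show ?thesis
    by (rule acc_wfI)
qed

section \<open>Embedding of \<open>r\<close> and the lower bound on the height\<close>

definition start_conf :: "nat \<Rightarrow> config" where
  "start_conf x = (length P + 1, (\<lambda>_. 0)(K := x))"

text \<open>A clock that bounds the running time lets \<open>T\<close> follow an accepting run to
  its end and exit to the kept number.\<close>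

lemma run_trancl:
  assumes "q \<le> length P" "(q, \<rho>) \<in> confs" "\<rho> (K + 1) = n" "accepts_in P n (q, \<rho>)"
  shows "(start_conf (\<rho> K), (q, \<rho>)) \<in> T\<^sup>+"
  using assms
proof (induction n arbitrary: q \<rho>)
  case (0 q \<rho>)
  then have "q = length P" "\<rho> 0 = 1"
    by (simp_all add: accepts_in_def halted_def)
  then show ?case
    using 0 by (intro r_into_trancl) (auto simp: T_def start_conf_def trans_def bounded_def)
next
  case (Suc n q \<rho>)
  show ?case
  proof (cases "q < length P")
    case True
    define q' where "q' = min (fst (exec (P ! q) (q, \<rho>))) (length P)"
    define \<rho>' where "\<rho>' = (snd (exec (P ! q) (q, \<rho>)))(K + 1 := n)"
    have t: "trans q' q \<rho>' \<rho>"
      using True Suc.prems(3) by (simp add: trans_def q'_def \<rho>'_def)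
    have b: "(q', \<rho>') \<in> confs"
      using Suc.prems(2) exec_reg_ge[OF True] by (simp add: bounded_def q'_def \<rho>'_def)
    have "agree (step P (q, \<rho>)) (q', \<rho>')"
      using trans_step_agree[OF True t] by (simp add: agree_def)
    then have "accepts_in P n (q', \<rho>')"
      using accepts_in_agree Suc.prems(4) by (simp add: accepts_in_Suc)
    moreover have "q' \<le> length P" "\<rho>' (K + 1) = n"
      by (simp_all add: q'_def \<rho>'_def)
    ultimately have "(start_conf (\<rho>' K), (q', \<rho>')) \<in> T\<^sup>+"
      using Suc.IH b by blast
    moreover have "\<rho>' K = \<rho> K"
      using exec_reg_ge[OF True, of K] by (simp add: \<rho>'_def)
    moreover have "((q', \<rho>'), (q, \<rho>)) \<in> T"
      using t b Suc.prems(2) by (simp add: T_def)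
    ultimately show ?thesis
      by (metis trancl_into_trancl)
  next
    case False
    \<comment> \<open>The machine has halted before the clock ran out; \<open>trans\<close> permits
      the exit with any clock value.\<close>
    then have "q = length P" "\<rho> 0 = 1"
      using Suc.prems accepts_in_halted by auto
    then show ?thesis
      using Suc.prems by (intro r_into_trancl) (auto simp: T_def start_conf_def trans_def bounded_def)
  qed
qed

lemma start_conf_trancl:
  assumes "(y, x) \<in> r - Id"
  shows "(start_conf y, start_conf x) \<in> T\<^sup>+"
proof -
  obtain n where n: "accepts_in P n (initial [y, x])"
    using assms accepts_in_initial by blast
  \<comment> \<open>The clock starts at the bound \<open>n\<close>. As \<open>x\<close> and
    \<open>y\<close> differ, \<open>min x y\<close> is less than exactly one of them, as the witness
    register requires.\<close>
  define \<rho> where "\<rho> = (\<lambda>_. 0)(0 := y, 1 := x, K := y, K + 1 := n, K + 2 := min x y)"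
  have t: "trans 0 (length P + 1) \<rho> (snd (start_conf x))"
    using assms K by (auto simp: trans_def \<rho>_def start_conf_def)
  have b: "(0, \<rho>) \<in> confs" "start_conf x \<in> confs"
    using K by (auto simp: bounded_def \<rho>_def start_conf_def)
  have "agree (initial [y, x]) (0, \<rho>)"
    using trans_start_agree[OF t] by (simp add: agree_def \<rho>_def start_conf_def)
  then have "accepts_in P n (0, \<rho>)"
    using accepts_in_agree n by blast
  moreover have "\<rho> (K + 1) = n"
    by (simp add: \<rho>_def)
  ultimately have "(start_conf (\<rho> K), (0, \<rho>)) \<in> T\<^sup>+"
    using run_trancl b(1) by blast
  moreover have "((0, \<rho>), start_conf x) \<in> T"
    using t b by (simp add: T_def start_conf_def)
  ultimately show ?thesis
    by (simp add: \<rho>_def trancl_into_trancl)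
qed

text \<open>Ranks of start configurations increase along \<open>r\<close>, so the lower top element
  has rank at least the type of \<open>r\<close>. The upper one makes the bound strict, since the
  height is a supremum of ranks, not of their successors.\<close>

lemma ordtype_less_height:
  "ordtype r < ordinal_height (lists (letters (length P + 4) (K + 3))) (word_rel T)"
proof -
  have wf: "wf (word_rel T)"
    by (rule wf_word_rel[OF wf_T T_subset])
  define rank where "rank c = ordinal_rank (word_rel T) (code c)" for c
  have rank: "rank c < rank d" if "(c, d) \<in> T\<^sup>+" for c d
    unfolding rank_def by (rule ordinal_rank_less_trancl[OF wf code_trancl[OF T_subset that]])
  define top where "top i = (length P + 2 + i, \<lambda>_ :: nat. 0 :: nat)" for i
  have "ordtype r \<le> rank (top 0)"
  proof (rule ordtype_le_strict_bound[OF wo, where h = "\<lambda>x. rank (start_conf x)"])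
    show "rank (start_conf y) < rank (start_conf x)" if "(y, x) \<in> r - Id" for x y
      by (rule rank[OF start_conf_trancl[OF that]])
    show "rank (start_conf x) < rank (top 0)" for x
      by (intro rank r_into_trancl) (auto simp: T_def start_conf_def top_def trans_def bounded_def)
  qed
  also have "rank (top 0) < rank (top 1)"
    by (intro rank r_into_trancl) (auto simp: T_def top_def trans_def bounded_def)
  also have "rank (top 1) \<le> ordinal_height (lists (letters (length P + 4) (K + 3))) (word_rel T)"
    unfolding rank_def code_def
    by (intro ordinal_rank_le_height enc_in_lists) (simp add: top_def bounded_def)
  finally show ?thesis .
qed

end

theorem theorem2:
  fixes \<alpha> :: cord
  assumes "\<alpha> < omega1CK"
  shows "\<exists>(A :: nat list set) R. automatic A [(2, tuples R)] \<and> wf R \<and> \<alpha> < ordinal_height A R"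
proof -
  obtain r P where r: "Well_order r" "\<alpha> = ordtype r"
    and P: "\<And>x y. computes P [x, y] (if (x, y) \<in> r then 1 else 0)"
    using less_omega1CK_computable[OF assms] unfolding computable_ord_def computable_rel_def by blast
  \<comment> \<open>The sum bounds every register occurring in \<open>P\<close>; adding 2 makes the
    bound strict and reserves the two input registers.\<close>
  define K where "K = 2 + sum_list (map reg P)"
  interpret order_machine P K r
  proof
    show "reg a < K" if "a \<in> set P" for a
      using member_le_sum_list[of "reg a" "map reg P"] that by (simp add: K_def)
  qed (simp_all add: r P K_def)
  show ?thesis
    using automatic_word_rel[OF local_rel_trans T_def] wf_word_rel[OF wf_T T_subset]
      ordtype_less_height r(2) by blast
qed

end
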